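(* Let $G_\star(t,x)$, $t\in\mathbb{R}$, $x\in\mathbb{T}=\mathbb{R}/\mathbb{Z}$, be a positive function, periodic in $x$, such that the function with swapped variables $G(t,x):=G_\star(x,t)$ is a KBM-function (in dimension $d=1$), and such that $$M:=\sup_{x\in\mathbb{R},\,t\ge 0}\frac{1}{G_\star(t,x)}<\infty .$$ Let $p\in\mathbb{R}$ and, for $\varepsilon>0$, let $X^\varepsilon$ be the solution to the initial value problem $$\frac{dX^\varepsilon}{dt}=\frac{1}{G_\star\left(t,\frac{X^\varepsilon}{\varepsilon}\right)},\qquad X^\varepsilon(0)=p .$$ Then there is a Lipschitz continuous function $X^0(t)$ (independent of $\varepsilon$) such that for every $T>0$ $$|X^\varepsilon(t)-X^0(t)|\le C(T)\,\varepsilon,\qquad t\in[0,T],$$ where $C(T)$ is a positive constant depending only on $T$ and $G_\star$. Furthermore, if $G_\star(t,\eta)$ does not depend on $t$ and is periodic in $\eta$, then $X^0(t)=p_0+\beta t$ for some $p_0,\beta\in\mathbb{R}$.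
   Context: KBM-function (Krylov, Bogolyubov, Mitropolski): a function $G(t,x)$, continuous in $t$ and $x$ on $[0,\infty)\times\mathbb{R}^d$, is called a KBM-function if (i) there is a constant $L>0$ with $|G(t,x_1)-G(t,x_2)|\le L|x_1-x_2|$ for all $t\in[0,\infty)$ and $x_1,x_2\in\mathbb{R}^d$; and (ii) the average $G^0(y)=\lim_{\ell\to\infty}\frac1\ell\int_0^\ell G(\tau,y)\,d\tau$ exists, uniformly in $y$ on compact sets $D\subset\mathbb{R}^d$. Here $d=1$; functions on $\mathbb{T}$ are identified with 1-periodic functions on $\mathbb{R}$. *)

theory Defs
  imports "HOL-Analysis.Analysis"
begin

definition KBM_function ::
    "(real \<Rightarrow> 'a::euclidean_space \<Rightarrow> 'b::euclidean_space) \<Rightarrow> bool" where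
  "KBM_function G \<longleftrightarrow>
     continuous_on ({0..} \<times> UNIV) (\<lambda>(t, x). G t x) \<and>
     (\<exists>L>0. \<forall>t\<ge>0. \<forall>x1 x2. norm (G t x1 - G t x2) \<le> L * norm (x1 - x2)) \<and>
     (\<exists>G0. \<forall>D. compact D \<longrightarrow>
        uniform_limit D (\<lambda>l y. (1 / l) *\<^sub>R integral {0..l} (\<lambda>\<tau>. G \<tau> y)) G0 at_top)"

definition ivp_solution ::
    "(real \<Rightarrow> real \<Rightarrow> real) \<Rightarrow> real \<Rightarrow> real \<Rightarrow> (real \<Rightarrow> real) \<Rightarrow> bool" where
  "ivp_solution Gstar \<epsilon> p X \<longleftrightarrow>
     X 0 = p \<and>
     (\<forall>t\<ge>0. (X has_real_derivative 1 / Gstar t (X t / \<epsilon>)) (at t within {0..}))"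

end

theory Submission
  imports Defs
begin

text \<open>Write \<open>F t\<close> for the antiderivative of \<open>Gstar t\<close> vanishing at \<open>0\<close>, and put \<open>m t = F t 1\<close>, the
mean of \<open>Gstar t\<close> over a period. The limit \<open>X0\<close> solves \<open>X0' = 1 / m t\<close>, \<open>X0 0 = p\<close>. The corrector
\<open>Q t \<eta> = F t \<eta> / m t - \<eta>\<close> is 1-periodic in \<open>\<eta>\<close>, bounded by \<open>1\<close>, and Lipschitz in \<open>t\<close> with constant
\<open>2 L M\<close>. Along a solution, \<open>R t = (X t - X0 t) / \<epsilon> + Q t (X t / \<epsilon>)\<close> would have zero derivative if the
first argument of \<open>Q\<close> were frozen, so \<open>R\<close> is Lipschitz with the constant of \<open>Q\<close>, uniformly
in \<open>\<epsilon>\<close>, and \<open>\<bar>X t - X0 t\<bar> \<le> (2 L M t + 2) \<epsilon>\<close>.\<close>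

section \<open>Calculus on the real line\<close>

text \<open>Stands in for the mean value inequality when \<open>R\<close> need not be
  differentiable. The bound is additive over adjacent intervals, and a short interval around
  \<open>x\<close> is split at \<open>x\<close>; bisection does the rest.\<close>

lemma lipschitz_from_local_bound:
  fixes R :: "real \<Rightarrow> real"
  assumes "a \<le> b"
    and local: "\<And>x. x \<in> {a..b} \<Longrightarrow> \<exists>d>0. \<forall>y\<in>{a..b}. \<bar>y - x\<bar> < d \<longrightarrow> \<bar>R y - R x\<bar> \<le> K * \<bar>y - x\<bar>"
  shows "\<bar>R b - R a\<bar> \<le> K * (b - a)"
proof -
  define P where "P u v \<longleftrightarrow> a \<le> u \<and> v \<le> b \<longrightarrow> \<bar>R v - R u\<bar> \<le> K * (v - u)" for u v
  have "P a b"
    using \<open>a \<le> b\<close>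
  proof (induction rule: Bolzano)
    case (trans u v w)
    show ?case
      unfolding P_def
    proof
      assume "a \<le> u \<and> w \<le> b"
      with trans have "\<bar>R v - R u\<bar> \<le> K * (v - u)" "\<bar>R w - R v\<bar> \<le> K * (w - v)"
        by (auto simp: P_def)
      then show "\<bar>R w - R u\<bar> \<le> K * (w - u)"
        by (simp add: algebra_simps)
    qed
  next
    case (local x)
    then obtain d where "d > 0"
      and d: "\<And>y. y \<in> {a..b} \<Longrightarrow> \<bar>y - x\<bar> < d \<Longrightarrow> \<bar>R y - R x\<bar> \<le> K * \<bar>y - x\<bar>"
      using assms(2)[of x] by auto
    have "P u v" if uv: "u \<le> x" "x \<le> v" "v - u < d" for u v
      unfolding P_def
    proof
      assume "a \<le> u \<and> v \<le> b"
      then have "\<bar>R u - R x\<bar> \<le> K * (x - u)" "\<bar>R v - R x\<bar> \<le> K * (v - x)"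
        using d[of u] d[of v] uv by auto
      then show "\<bar>R v - R u\<bar> \<le> K * (v - u)"
        by (simp add: algebra_simps)
    qed
    with \<open>d > 0\<close> show ?case by blast
  qed
  then show ?thesis by (simp add: P_def)
qed

lemma continuous_antiderivative:
  fixes f :: "real \<Rightarrow> real"
  assumes "continuous_on UNIV f"
  shows "\<exists>F. F c = d \<and> (\<forall>x. (F has_real_derivative f x) (at x))"
proof -
  have "\<exists>F. \<forall>x :: real. - \<infinity> < ereal x \<longrightarrow> ereal x < \<infinity> \<longrightarrow> (F has_vector_derivative f x) (at x)"
    using assms by (intro einterval_antiderivative) (auto simp: continuous_on_eq_continuous_at)
  then obtain F where F: "\<And>x. (F has_real_derivative f x) (at x)"
    by (auto simp: has_real_derivative_iff_has_vector_derivative)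
  have "((\<lambda>x. F x - F c + d) has_real_derivative f x) (at x)" for x
    by (auto intro!: derivative_eq_intros F)
  then show ?thesis
    by (intro exI[of _ "\<lambda>x. F x - F c + d"]) auto
qed

lemma abs_diff_le_of_deriv_le:
  fixes f :: "real \<Rightarrow> real"
  assumes "\<And>x. x \<in> {a..b} \<Longrightarrow> (f has_real_derivative f' x) (at x)"
    and "\<And>x. x \<in> {a..b} \<Longrightarrow> \<bar>f' x\<bar> \<le> B" and "a \<le> b"
  shows "\<bar>f b - f a\<bar> \<le> B * (b - a)"
  using field_differentiable_bound[of "{a..b}" f f' B b a] assms
  by (auto intro: has_field_derivative_at_within)

lemma periodic_add_of_int:
  fixes f :: "real \<Rightarrow> 'a"
  assumes "\<And>x. f (x + 1) = f x"
  shows "f (x + of_int n) = f x"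
proof (induction n arbitrary: x rule: int_induct[of _ 0])
  case (step1 i)
  then show ?case using assms[of "x + of_int i"] by (simp add: add.assoc)
next
  case (step2 i)
  then show ?case using assms[of "x + of_int (i - 1)"] by (simp add: algebra_simps)
qed simp

section \<open>Mean and corrector of a periodic function\<close>

text \<open>Because of the swapped variables, the spatial Lipschitz condition of the KBM function
  becomes a Lipschitz condition in time \<open>t\<close>.\<close>

locale periodic_lipschitz =
  fixes g :: "real \<Rightarrow> real \<Rightarrow> real" and L M :: real
  assumes pos: "\<And>t x. 0 < g t x"
    and per: "\<And>t x. g t (x + 1) = g t x"
    and cont: "\<And>t. continuous_on UNIV (g t)"
    and lips: "\<And>t s x. \<bar>g t x - g s x\<bar> \<le> L * \<bar>t - s\<bar>"
    and bound: "\<And>t x. 0 \<le> t \<Longrightarrow> 1 / g t x \<le> M"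
    and L_pos: "0 < L"
begin

text \<open>The choice depends on the function \<open>g t\<close> only, so that equal functions get equal primitives.\<close>

definition F :: "real \<Rightarrow> real \<Rightarrow> real"
  where "F t = (SOME F. F 0 = 0 \<and> (\<forall>x. (F has_real_derivative g t x) (at x)))"

definition m :: "real \<Rightarrow> real"
  where "m t = F t 1"

definition Q :: "real \<Rightarrow> real \<Rightarrow> real"
  where "Q t \<eta> = F t \<eta> / m t - \<eta>"

lemma F_0: "F t 0 = 0" and F_deriv: "(F t has_real_derivative g t x) (at x)"
  using someI_ex[OF continuous_antiderivative[OF cont[of t], of 0 0]]
  by (auto simp: F_def)

lemma F_less: "x < y \<Longrightarrow> F t x < F t y"
  by (rule DERIV_pos_imp_increasing) (use F_deriv pos in blast)+

lemma F_le: "x \<le> y \<Longrightarrow> F t x \<le> F t y"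
  using F_less[of x y t] by (cases "x = y") auto

lemma m_pos: "0 < m t"
  using F_less[of 0 1 t] by (simp add: m_def F_0)

lemma M_pos: "0 < M"
  using bound[of 0 0] pos[of 0 0] by (smt (verit) zero_less_divide_1_iff)

text \<open>By the mean value theorem the mean \<open>m t\<close> is a value of \<open>g t\<close>,
  so it inherits the bound.\<close>

lemma inverse_m_le:
  assumes "0 \<le> t"
  shows "1 / m t \<le> M"
proof -
  obtain z where "F t 1 - F t 0 = g t z"
    using MVT2[of 0 1 "F t" "g t"] F_deriv by auto
  with bound[OF assms, of z] show ?thesis
    by (simp add: m_def F_0)
qed

lemma F_Suc: "F t (x + 1) = F t x + m t"
proof -
  have "((\<lambda>x. F t (x + 1) - F t x) has_real_derivative 0) (at x)" for x
    by (rule derivative_eq_intros DERIV_chain2[OF F_deriv] F_deriv refl)+ (simp add: per)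
  then have "F t (x + 1) - F t x = F t (0 + 1) - F t 0"
    by (rule DERIV_isconst_all[rule_format, of "\<lambda>x. F t (x + 1) - F t x"])
  then show ?thesis by (simp add: m_def F_0)
qed

text \<open>\<open>F t\<close> grows by \<open>m t\<close> over each period, and division by
  \<open>m t\<close> turns this into the growth of the identity. Estimates on \<open>F\<close> over
  one period thus give estimates on \<open>Q\<close> everywhere.\<close>

lemma Q_frac: "Q t \<eta> = Q t (frac \<eta>)"
proof -
  have "Q t (x + 1) = Q t x" for x
    using m_pos[of t] by (simp add: Q_def F_Suc add_divide_distrib)
  from periodic_add_of_int[of "Q t", OF this, of "frac \<eta>" "\<lfloor>\<eta>\<rfloor>"] show ?thesis
    by (simp add: frac_def)
qed

lemma F_frac_bounds: "0 \<le> F t (frac \<eta>)" "F t (frac \<eta>) \<le> m t"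
  using F_le[of 0 "frac \<eta>" t] F_le[of "frac \<eta>" 1 t] frac_lt_1[of \<eta>] by (auto simp: F_0 m_def)

lemma Q_bound: "\<bar>Q t \<eta>\<bar> \<le> 1"
proof -
  have "0 \<le> F t (frac \<eta>) / m t" "F t (frac \<eta>) / m t \<le> 1"
    using F_frac_bounds[of t \<eta>] m_pos[of t] by auto
  moreover have "Q t \<eta> = F t (frac \<eta>) / m t - frac \<eta>"
    by (subst Q_frac) (simp only: Q_def)
  ultimately show ?thesis
    using frac_ge_0[of \<eta>] frac_lt_1[of \<eta>] by linarith
qed

text \<open>The difference \<open>F t - F s\<close> vanishes at 0 and has slope at most
  \<open>L * \<bar>t - s\<bar>\<close>.\<close>

lemma F_lipschitz:
  assumes "0 \<le> r" "r \<le> 1"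
  shows "\<bar>F t r - F s r\<bar> \<le> L * \<bar>t - s\<bar>"
proof -
  have "\<bar>(F t r - F s r) - (F t 0 - F s 0)\<bar> \<le> (L * \<bar>t - s\<bar>) * (r - 0)"
    by (rule abs_diff_le_of_deriv_le[where f = "\<lambda>x. F t x - F s x"
          and f' = "\<lambda>x. g t x - g s x"]) (use lips assms in \<open>auto intro!: DERIV_diff F_deriv\<close>)
  also have "\<dots> \<le> L * \<bar>t - s\<bar>"
    using assms L_pos by (simp add: mult_left_le)
  finally show ?thesis by (simp add: F_0)
qed

lemma Q_lipschitz:
  assumes "0 \<le> t"
  shows "\<bar>Q t \<eta> - Q s \<eta>\<bar> \<le> 2 * L * M * \<bar>t - s\<bar>"
proof -
  define r where "r = frac \<eta>"
  have r: "0 \<le> r" "r \<le> 1" by (auto simp: r_def less_imp_le[OF frac_lt_1])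
  define D where "D = L * \<bar>t - s\<bar>"
  have "D \<ge> 0" using L_pos by (simp add: D_def)
  have q: "0 \<le> F s r / m s" "F s r / m s \<le> 1"
    using F_frac_bounds[of s \<eta>] m_pos[of s] by (auto simp: r_def)
  have "Q t \<eta> - Q s \<eta> = F t r / m t - F s r / m s"
    by (subst (1 2) Q_frac) (simp add: Q_def r_def)
  \<comment> \<open>With \<open>m t\<close> as the only outer denominator, the bound
    \<open>M\<close> is needed at \<open>t\<close> alone, and the ratio at \<open>s\<close> lies
    between 0 and 1. Each of the two summands is at most \<open>D\<close>, whence the factor
    2.\<close>
  also have "\<dots> = ((F t r - F s r) + F s r / m s * (m s - m t)) / m t"
    using m_pos[of s] m_pos[of t] by (simp add: field_simps)
  finally have "\<bar>Q t \<eta> - Q s \<eta>\<bar> =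
      \<bar>(F t r - F s r) + F s r / m s * (m s - m t)\<bar> * (1 / m t)"
    using m_pos[of t] by (simp only: abs_divide) simp
  also have "\<dots> \<le> (D + D) * M"
  proof (rule mult_mono)
    have "\<bar>m s - m t\<bar> \<le> D"
      using F_lipschitz[of 1 s t] by (simp add: D_def m_def abs_minus_commute[of t s])
    then have "\<bar>F s r / m s\<bar> * \<bar>m s - m t\<bar> \<le> 1 * D"
      using q by (intro mult_mono) simp_all
    then have "\<bar>F s r / m s * (m s - m t)\<bar> \<le> D"
      by (simp only: abs_mult mult_1)
    then show "\<bar>(F t r - F s r) + F s r / m s * (m s - m t)\<bar> \<le> D + D"
      using abs_triangle_ineq[of "F t r - F s r" "F s r / m s * (m s - m t)"] F_lipschitz[OF r, of t s]
      unfolding D_def by linarith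
  qed (use inverse_m_le[OF assms] m_pos[of t] \<open>D \<ge> 0\<close> in auto)
  finally show ?thesis by (simp add: D_def algebra_simps)
qed

lemma continuous_inverse_m: "continuous_on UNIV (\<lambda>t. 1 / m t)"
proof -
  have "L-lipschitz_on UNIV m"
    using F_lipschitz[of 1] L_pos by (intro lipschitz_onI) (auto simp: m_def dist_real_def)
  then have "continuous_on UNIV m"
    by (rule lipschitz_on_continuous_on)
  moreover have "m t \<noteq> 0" for t using m_pos[of t] by simp
  ultimately show ?thesis
    by (intro continuous_intros) auto
qed

section \<open>Averaging estimate and properties of the limit\<close>

lemma averaging_estimate:
  assumes Y: "\<And>t. (Y has_real_derivative 1 / m t) (at t)" and Y0: "Y 0 = p"
    and X: "ivp_solution g \<epsilon> p X" and "\<epsilon> > 0" and "0 \<le> T"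
  shows "\<bar>X T - Y T\<bar> \<le> (2 * L * M * T + 2) * \<epsilon>"
proof -
  have X0: "X 0 = p"
    and X': "\<And>t. t \<ge> 0 \<Longrightarrow> (X has_real_derivative 1 / g t (X t / \<epsilon>)) (at t within {0..})"
    using X by (auto simp: ivp_solution_def)
  define R where "R t = (X t - Y t) / \<epsilon> + Q t (X t / \<epsilon>)" for t
  have "\<bar>R T - R 0\<bar> \<le> (2 * L * M) * T + e" if "e > 0" for e
  proof -
    \<comment> \<open>Slack for the remainder in the definition of the derivative. The denominator
      \<open>T + 1\<close> gives \<open>e' * T \<le> e\<close> and is nonzero even for
      \<open>T = 0\<close>.\<close>
    define e' where "e' = e / (T + 1)"
    have "e' > 0" using that \<open>0 \<le> T\<close> by (simp add: e'_def)
    have "\<bar>R T - R 0\<bar> \<le> (2 * L * M + e') * (T - 0)"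
    proof (rule lipschitz_from_local_bound[OF \<open>0 \<le> T\<close>])
      fix s assume s: "s \<in> {0..T}"
      \<comment> \<open>This is \<open>R\<close> with the slow argument of \<open>Q\<close> frozen
        at \<open>s\<close>. The chain rule applies to it, and it agrees with \<open>R\<close> at
        \<open>s\<close>.\<close>
      define S where "S t = (X t - Y t) / \<epsilon> + Q s (X t / \<epsilon>)" for t
      define G where "G = g s (X s / \<epsilon>)"
      have "G > 0" using pos by (simp add: G_def)
      have Q': "(Q s has_real_derivative G / m s - 1) (at (X s / \<epsilon>))"
        unfolding Q_def[abs_def] G_def
        by (intro DERIV_diff DERIV_cdivide F_deriv DERIV_ident)
      have X's: "(X has_real_derivative 1 / G) (at s within {0..})"
        using X' s by (auto simp: G_def)
      have "(S has_real_derivative (1 / G - 1 / m s) / \<epsilon> + (G / m s - 1) * (1 / G / \<epsilon>))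
          (at s within {0..})"
        unfolding S_def[abs_def]
        by (intro DERIV_add DERIV_cdivide DERIV_diff X's has_field_derivative_at_within[OF Y]
            DERIV_chain2[where f = "Q s" and g = "\<lambda>t. X t / \<epsilon>", OF Q'])
      \<comment> \<open>The corrector is built for this cancellation: its slope times the fast speed
        is the averaged speed minus the true one, over \<open>\<epsilon>\<close>.\<close>
      also have "(1 / G - 1 / m s) / \<epsilon> + (G / m s - 1) * (1 / G / \<epsilon>) = 0"
        using \<open>G > 0\<close> \<open>\<epsilon> > 0\<close> m_pos[of s] by (simp add: field_simps)
      finally have "(S has_derivative (*) 0) (at s within {0..})"
        by (simp only: has_field_derivative_def)
      then obtain d where "d > 0"
        and d: "\<And>y. y \<in> {0..} \<Longrightarrow> \<bar>y - s\<bar> < d \<Longrightarrow> \<bar>S y - S s\<bar> \<le> e' * \<bar>y - s\<bar>"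
        using \<open>e' > 0\<close> unfolding has_derivative_within_alt by fastforce
      have "\<bar>R y - R s\<bar> \<le> (2 * L * M + e') * \<bar>y - s\<bar>" if "y \<in> {0..T}" "\<bar>y - s\<bar> < d" for y
      proof -
        \<comment> \<open>The first bracket moves only the slow argument and costs
          \<open>2 * L * M\<close>; the second costs only the slack \<open>e'\<close>.\<close>
        have "R y - R s = (Q y (X y / \<epsilon>) - Q s (X y / \<epsilon>)) + (S y - S s)"
          by (simp add: R_def S_def)
        then show ?thesis
          using Q_lipschitz[of y "X y / \<epsilon>" s] d[of y] that
          by (simp add: distrib_right)
      qed
      with \<open>d > 0\<close> show "\<exists>d>0. \<forall>y\<in>{0..T}. \<bar>y - s\<bar> < d \<longrightarrow>
          \<bar>R y - R s\<bar> \<le> (2 * L * M + e') * \<bar>y - s\<bar>"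
        by blast
    qed
    moreover have "e' * T \<le> e"
      using that \<open>0 \<le> T\<close> by (simp add: e'_def field_simps)
    ultimately show ?thesis by (simp add: distrib_right)
  qed
  then have "\<bar>R T - R 0\<bar> \<le> 2 * L * M * T"
    by (rule field_le_epsilon)
  \<comment> \<open>\<open>X\<close> and \<open>Y\<close> start at the same point, so only two
    corrector values remain, each at most 1 in size: this is the constant 2.\<close>
  moreover have "(X T - Y T) / \<epsilon> = (R T - R 0) + Q 0 (X 0 / \<epsilon>) - Q T (X T / \<epsilon>)"
    by (simp add: R_def X0 Y0)
  ultimately have "\<bar>(X T - Y T) / \<epsilon>\<bar> \<le> 2 * L * M * T + 2"
    using Q_bound[of 0 "X 0 / \<epsilon>"] Q_bound[of T "X T / \<epsilon>"] by linarith
  then show ?thesis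
    using \<open>\<epsilon> > 0\<close> by (simp add: abs_divide pos_divide_le_eq)
qed

lemma averaged_lipschitz:
  assumes Y: "\<And>t. (Y has_real_derivative 1 / m t) (at t)"
  shows "M-lipschitz_on {0..} Y"
proof (rule lipschitz_onI)
  fix x y :: real assume "x \<in> {0..}" "y \<in> {0..}"
  then have "norm (Y x - Y y) \<le> M * norm (x - y)"
    using inverse_m_le m_pos
    by (intro field_differentiable_bound[of "{0..}" Y "\<lambda>t. 1 / m t"])
      (auto intro: has_field_derivative_at_within[OF Y] simp: less_imp_le)
  then show "dist (Y x) (Y y) \<le> M * dist x y" by (simp add: dist_norm)
qed (use M_pos in simp)

lemma averaged_linear:
  assumes Y: "\<And>t. (Y has_real_derivative 1 / m t) (at t)" and "\<And>t s. g t = g s"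
  shows "Y t = Y 0 + 1 / m 0 * t"
proof -
  have "m t = m 0" for t
    using assms(2)[of t 0] by (simp add: m_def F_def)
  then have "((\<lambda>t. Y t - 1 / m 0 * t) has_real_derivative 1 / m 0 - 1 / m 0) (at t)" for t
    using DERIV_diff[OF Y DERIV_cmult_Id[of "1 / m 0"], of t] by metis
  then have "((\<lambda>t. Y t - 1 / m 0 * t) has_real_derivative 0) (at t)" for t
    by (simp only: diff_self)
  then have "Y t - 1 / m 0 * t = Y 0 - 1 / m 0 * 0"
    by (rule DERIV_isconst_all[rule_format, of "\<lambda>t. Y t - 1 / m 0 * t"])
  then show ?thesis by simp
qed

end

section \<open>Reduction of the theorem to the periodic Lipschitz setting\<close>

theorem theorem1:
  fixes Gstar :: "real \<Rightarrow> real \<Rightarrow> real"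
  assumes positive: "\<forall>t x. 0 < Gstar t x"
    and periodic: "\<forall>t x. Gstar t (x + 1) = Gstar t x"
    and KBM: "KBM_function (\<lambda>t x. Gstar x t)"
    and M_finite: "(SUP (x, t) \<in> UNIV \<times> {0..}. ereal (1 / Gstar t x)) < \<infinity>"
  shows "\<exists>C :: real \<Rightarrow> real. (\<forall>T>0. 0 < C T) \<and>
    (\<forall>(p :: real) (X :: real \<Rightarrow> real \<Rightarrow> real).
       (\<forall>\<epsilon>>0. ivp_solution Gstar \<epsilon> p (X \<epsilon>)) \<longrightarrow>
       (\<exists>X0 :: real \<Rightarrow> real.
          (\<exists>L. L-lipschitz_on {0..} X0) \<and>
          (\<forall>T>0. \<forall>\<epsilon>>0. \<forall>t\<in>{0..T}. \<bar>X \<epsilon> t - X0 t\<bar> \<le> C T * \<epsilon>) \<and>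
          ((\<forall>t s \<eta>. Gstar t \<eta> = Gstar s \<eta>) \<longrightarrow>
             (\<exists>p0 \<beta>. \<forall>t\<ge>0. X0 t = p0 + \<beta> * t))))"
proof -
  have cont2: "continuous_on ({0..} \<times> UNIV) (\<lambda>(\<eta>, t). Gstar t \<eta>)"
    using KBM by (simp add: KBM_function_def)
  obtain L where "L > 0" and L: "\<And>\<eta> t s. \<eta> \<ge> 0 \<Longrightarrow> \<bar>Gstar t \<eta> - Gstar s \<eta>\<bar> \<le> L * \<bar>t - s\<bar>"
    using KBM by (auto simp only: KBM_function_def real_norm_def)
  have shift: "Gstar t (x + of_int n) = Gstar t x" for t x n
    by (rule periodic_add_of_int) (use periodic in auto)
  define S where "S = (SUP (x, t) \<in> UNIV \<times> {0..}. ereal (1 / Gstar t x))"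
  have S: "ereal (1 / Gstar t x) \<le> S" if "t \<ge> 0" for t x
    unfolding S_def by (rule SUP_upper2[of "(x, t)"]) (use that in auto)
  moreover have "S < \<infinity>" using M_finite by (simp add: S_def)
  \<comment> \<open>The supremum also dominates the real number \<open>1 / Gstar 0 0\<close>, so it
    is not minus infinity.\<close>
  ultimately obtain M where M: "S = ereal M"
    using S[of 0 0] by (cases S) auto
  interpret periodic_lipschitz Gstar L M
  proof
    fix t :: real
    have "isCont (Gstar t) x" for x
    proof -
      \<comment> \<open>Continuity is given only for nonnegative phase. The integer shift moves
        \<open>x\<close> to \<open>1 + frac x\<close>, inside the open half-line, where continuity
        is two-sided; periodicity brings it back.\<close>
      define n where "n = 1 - \<lfloor>x\<rfloor>"
      have "continuous_on {0..} (\<lambda>\<eta>. (\<lambda>(\<eta>, t). Gstar t \<eta>) (\<eta>, t))"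
        by (rule continuous_on_compose2[OF cont2]) (auto intro!: continuous_intros)
      then have "continuous_on {0<..} (Gstar t)"
        by (auto intro: continuous_on_subset)
      moreover have "x + of_int n \<in> {0<..}" by (simp add: n_def) linarith
      ultimately have "isCont (Gstar t) (x + of_int n)"
        by (simp add: continuous_on_eq_continuous_at)
      then have "isCont (\<lambda>x. Gstar t (x + of_int n)) x"
        by (rule isCont_o2[where f = "\<lambda>x. x + of_int n" and g = "Gstar t", rotated]) simp
      then show ?thesis by (simp add: shift)
    qed
    then show "continuous_on UNIV (Gstar t)"
      by (simp add: continuous_on_eq_continuous_at)
  next
    fix t s x :: real
    show "\<bar>Gstar t x - Gstar s x\<bar> \<le> L * \<bar>t - s\<bar>"
      using L[of "frac x" t s] shift[of _ "frac x" "\<lfloor>x\<rfloor>"] by (simp add: frac_def)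
  next
    fix t x :: real assume "t \<ge> 0"
    then show "1 / Gstar t x \<le> M" using S M by simp
  qed (use positive periodic \<open>L > 0\<close> in auto)
  \<comment> \<open>Built from \<open>L\<close> and \<open>M\<close> only, hence chosen before
    \<open>p\<close> and the solutions. It increases with \<open>T\<close>, so the estimate at time
    \<open>t\<close> serves for all \<open>T \<ge> t\<close>.\<close>
  define C where "C T = 2 * L * M * T + 2" for T
  show ?thesis
  proof (rule exI[of _ C], intro conjI allI impI)
    fix T :: real assume "T > 0"
    then show "0 < C T" using \<open>L > 0\<close> M_pos by (simp add: C_def add_pos_pos)
  next
    fix p :: real and X :: "real \<Rightarrow> real \<Rightarrow> real"
    assume X: "\<forall>\<epsilon>>0. ivp_solution Gstar \<epsilon> p (X \<epsilon>)"
    obtain Y where Y: "Y 0 = p" "\<And>t. (Y has_real_derivative 1 / m t) (at t)"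
      using continuous_antiderivative[OF continuous_inverse_m] by blast
    have "\<bar>X \<epsilon> t - Y t\<bar> \<le> C T * \<epsilon>" if "\<epsilon> > 0" "t \<in> {0..T}" for T \<epsilon> t
    proof -
      have "\<bar>X \<epsilon> t - Y t\<bar> \<le> C t * \<epsilon>"
        unfolding C_def using that X by (intro averaging_estimate[OF Y(2,1)]) auto
      also have "\<dots> \<le> C T * \<epsilon>"
        using that \<open>L > 0\<close> M_pos by (auto simp: C_def intro!: mult_right_mono mult_left_mono)
      finally show ?thesis .
    qed
    moreover have "\<exists>p0 \<beta>. \<forall>t\<ge>0. Y t = p0 + \<beta> * t" if "\<forall>t s \<eta>. Gstar t \<eta> = Gstar s \<eta>"
      using averaged_linear[OF Y(2)] that by blast
    ultimately show "\<exists>X0. (\<exists>L. L-lipschitz_on {0..} X0) \<and>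
          (\<forall>T>0. \<forall>\<epsilon>>0. \<forall>t\<in>{0..T}. \<bar>X \<epsilon> t - X0 t\<bar> \<le> C T * \<epsilon>) \<and>
          ((\<forall>t s \<eta>. Gstar t \<eta> = Gstar s \<eta>) \<longrightarrow> (\<exists>p0 \<beta>. \<forall>t\<ge>0. X0 t = p0 + \<beta> * t))"
      using averaged_lipschitz[OF Y(2)] by blast
  qed
qed

end
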